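(* Consider the dimer system with $\chi=\frac12$: $$\begin{cases} i \dot{q}_0 = q_1 - i\gamma q_0 + \frac12\left(|q_0|^2 + |q_1|^2\right) q_0, \\ i \dot{q}_1 = q_0 + i \gamma q_1 + \frac12\left(|q_0|^2 + |q_1|^2\right) q_1. \end{cases}$$ If $\gamma\in[0,1)$, then all solutions are bounded (for all times). If $\gamma\ge1$, then there exist unbounded solutions.
   Context: $q_0,q_1$ are complex-valued functions of the real variable $t$, $\gamma$ is a real parameter, and the overdot denotes $d/dt$. Solutions exist globally in time. A solution is bounded if $|q_0(t)|^2+|q_1(t)|^2$ is a bounded function of $t\in\mathbb{R}$. *)

theory Defs
  imports "HOL-Analysis.Analysis"
begin

definition dimer_solution :: "real \<Rightarrow> (real \<Rightarrow> complex) \<Rightarrow> (real \<Rightarrow> complex) \<Rightarrow> bool" where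
  "dimer_solution \<gamma> q0 q1 \<longleftrightarrow>
     (\<forall>t. q0 differentiable (at t) \<and> q1 differentiable (at t) \<and>
        \<i> * vector_derivative q0 (at t) =
          q1 t - \<i> * of_real \<gamma> * q0 t
            + 1/2 * of_real ((cmod (q0 t))\<^sup>2 + (cmod (q1 t))\<^sup>2) * q0 t \<and>
        \<i> * vector_derivative q1 (at t) =
          q0 t + \<i> * of_real \<gamma> * q1 t
            + 1/2 * of_real ((cmod (q0 t))\<^sup>2 + (cmod (q1 t))\<^sup>2) * q1 t)"

definition bounded_solution :: "(real \<Rightarrow> complex) \<Rightarrow> (real \<Rightarrow> complex) \<Rightarrow> bool" where
  "bounded_solution q0 q1 \<longleftrightarrow>
     bounded (range (\<lambda>t. (cmod (q0 t))\<^sup>2 + (cmod (q1 t))\<^sup>2))"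

end

theory Submission
  imports Defs
begin

text \<open>
  The nonlinearity is a real multiple of the identity, so it only rotates the common phase:
  multiplying a solution of the linear system by \<open>exp (-i\<phi>)\<close> with
  \<open>\<phi>' = (|p\<^sub>0|\<^sup>2 + |p\<^sub>1|\<^sup>2) / 2\<close> gives a solution of the dimer system with the same moduli.
  For \<open>\<gamma> < 1\<close>, the quantity \<open>|q\<^sub>0|\<^sup>2 + |q\<^sub>1|\<^sup>2 - 2\<gamma> Im (q\<^sub>1 * cnj q\<^sub>0)\<close> is conserved, and it dominates
  \<open>(1 - \<gamma>) (|q\<^sub>0|\<^sup>2 + |q\<^sub>1|\<^sup>2)\<close>. For \<open>\<gamma> \<ge> 1\<close>, the linear system, whose matrix has square
  \<open>(\<gamma>\<^sup>2 - 1) I\<close>, has unbounded solutions: linear ones if \<open>\<gamma> = 1\<close>, exponential ones otherwise.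
\<close>

text \<open>Solving for the derivatives, by multiplication with \<open>- \<i>\<close>, makes the
  derivative rules applicable. The cubic term stays separate as \<open>- \<i>\<close> times a real
  multiple of the component, the shape that differentiating a phase factor produces.\<close>

lemma dimer_solution_iff_has_vector_derivative:
  "dimer_solution \<gamma> q0 q1 \<longleftrightarrow>
     (\<forall>t. (q0 has_vector_derivative
             - \<i> * q1 t - of_real \<gamma> * q0 t
               - \<i> * (of_real (((cmod (q0 t))\<^sup>2 + (cmod (q1 t))\<^sup>2) / 2) * q0 t)) (at t) \<and>
          (q1 has_vector_derivative
             - \<i> * q0 t + of_real \<gamma> * q1 t
               - \<i> * (of_real (((cmod (q0 t))\<^sup>2 + (cmod (q1 t))\<^sup>2) / 2) * q1 t)) (at t))"
  (is "_ \<longleftrightarrow> (\<forall>t. (q0 has_vector_derivative ?f0 t) (at t) \<and> (q1 has_vector_derivative ?f1 t) (at t))")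
proof -
  have *: "q differentiable (at t) \<and> \<i> * vector_derivative q (at t) = r
      \<longleftrightarrow> (q has_vector_derivative - \<i> * r) (at t)" for q r and t :: real
  proof -
    have "\<i> * d = r \<longleftrightarrow> d = - \<i> * r" for d
      by (auto simp: field_simps)
    then show ?thesis
      by (metis differentiableI_vector vector_derivative_at vector_derivative_works)
  qed
  have eq: "?f0 t = - \<i> * (q1 t - \<i> * of_real \<gamma> * q0 t
            + 1/2 * of_real ((cmod (q0 t))\<^sup>2 + (cmod (q1 t))\<^sup>2) * q0 t)"
       "?f1 t = - \<i> * (q0 t + \<i> * of_real \<gamma> * q1 t
            + 1/2 * of_real ((cmod (q0 t))\<^sup>2 + (cmod (q1 t))\<^sup>2) * q1 t)" for t
    by (simp_all add: algebra_simps)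
  show ?thesis
    unfolding dimer_solution_def eq *[symmetric] by blast
qed

text \<open>Gain and loss give \<open>2 * \<gamma> * (|q1|^2 - |q0|^2)\<close> as the derivative of
  the squared norm, and \<open>Im (q1 * cnj q0)\<close> has derivative
  \<open>|q1|^2 - |q0|^2\<close>.\<close>

lemma dimer_solution_conserved:
  assumes "dimer_solution \<gamma> q0 q1"
  obtains C where "\<And>t. (cmod (q0 t))\<^sup>2 + (cmod (q1 t))\<^sup>2 - 2 * \<gamma> * Im (q1 t * cnj (q0 t)) = C"
proof -
  define E where "E t = (cmod (q0 t))\<^sup>2 + (cmod (q1 t))\<^sup>2 - 2 * \<gamma> * Im (q1 t * cnj (q0 t))" for t
  have E: "E = (\<lambda>t. (Re (q0 t))\<^sup>2 + (Im (q0 t))\<^sup>2 + ((Re (q1 t))\<^sup>2 + (Im (q1 t))\<^sup>2)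
      - 2 * \<gamma> * (Im (q1 t) * Re (q0 t) - Re (q1 t) * Im (q0 t)))"
    by (simp add: E_def fun_eq_iff cmod_power2)
  have "(E has_vector_derivative 0) (at t)" for t
  proof -
    \<comment> \<open>At fixed \<open>t\<close> the nonlinearity enters only through the real number
      \<open>m\<close>, whose terms cancel whatever its value.\<close>
    define m where "m = ((cmod (q0 t))\<^sup>2 + (cmod (q1 t))\<^sup>2) / 2"
    note d = assms[unfolded dimer_solution_iff_has_vector_derivative, rule_format, of t,
        folded m_def]
    have [derivative_intros]:
      "((\<lambda>t. Re (q0 t)) has_real_derivative Im (q1 t) - \<gamma> * Re (q0 t) + m * Im (q0 t)) (at t)"
      "((\<lambda>t. Im (q0 t)) has_real_derivative - Re (q1 t) - \<gamma> * Im (q0 t) - m * Re (q0 t)) (at t)"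
      "((\<lambda>t. Re (q1 t)) has_real_derivative Im (q0 t) + \<gamma> * Re (q1 t) + m * Im (q1 t)) (at t)"
      "((\<lambda>t. Im (q1 t)) has_real_derivative - Re (q0 t) + \<gamma> * Im (q1 t) - m * Re (q1 t)) (at t)"
      using d[THEN conjunct1] d[THEN conjunct2]
      by (auto simp: has_vector_derivative_complex_iff algebra_simps)
    have "(E has_real_derivative 0) (at t)"
      unfolding E by (rule derivative_eq_intros refl)+ (simp add: algebra_simps power2_eq_square)
    then show ?thesis
      by (simp add: has_real_derivative_iff_has_vector_derivative)
  qed
  then obtain C where "\<And>t. E t = C"
    using has_vector_derivative_zero_constant[of UNIV E] by auto
  then show thesis
    using that by (simp add: E_def)
qed

lemma bounded_dimer_solution:
  assumes "\<bar>\<gamma>\<bar> < 1" and "dimer_solution \<gamma> q0 q1"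
  shows "bounded_solution q0 q1"
proof -
  obtain C where C: "\<And>t. (cmod (q0 t))\<^sup>2 + (cmod (q1 t))\<^sup>2 - 2 * \<gamma> * Im (q1 t * cnj (q0 t)) = C"
    using dimer_solution_conserved[OF assms(2)] by blast
  have "(cmod (q0 t))\<^sup>2 + (cmod (q1 t))\<^sup>2 \<le> C / (1 - \<bar>\<gamma>\<bar>)" (is "?N t \<le> _") for t
  proof -
    have "2 * \<bar>Im (q1 t * cnj (q0 t))\<bar> \<le> 2 * (cmod (q0 t) * cmod (q1 t))"
      using abs_Im_le_cmod[of "q1 t * cnj (q0 t)"] by (simp add: norm_mult mult.commute)
    also have "\<dots> \<le> ?N t"
      using sum_squares_bound[of "cmod (q0 t)" "cmod (q1 t)"] by simp
    finally have "\<bar>\<gamma>\<bar> * (2 * \<bar>Im (q1 t * cnj (q0 t))\<bar>) \<le> \<bar>\<gamma>\<bar> * ?N t"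
      by (rule mult_left_mono) simp
    moreover have "2 * \<gamma> * Im (q1 t * cnj (q0 t)) \<le> \<bar>\<gamma>\<bar> * (2 * \<bar>Im (q1 t * cnj (q0 t))\<bar>)"
      using abs_ge_self[of "\<gamma> * Im (q1 t * cnj (q0 t))"] by (simp add: abs_mult)
    ultimately have "?N t * (1 - \<bar>\<gamma>\<bar>) \<le> C"
      using C[of t] by (simp add: algebra_simps)
    then show ?thesis
      using assms(1) by (simp add: pos_le_divide_eq)
  qed
  then show ?thesis
    unfolding bounded_solution_def by (intro boundedI[of _ "C / (1 - \<bar>\<gamma>\<bar>)"]) auto
qed

text \<open>Since \<open>cis\<close> has modulus 1, the coefficient of the nonlinearity is the same
  before and after the phase change. Explicit linear solutions thus yield explicit dimer solutions,
  with no appeal to an existence theorem.\<close>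

lemma dimer_solution_gauge:
  assumes p0: "\<And>t. (p0 has_vector_derivative - \<i> * p1 t - of_real \<gamma> * p0 t) (at t)"
    and p1: "\<And>t. (p1 has_vector_derivative - \<i> * p0 t + of_real \<gamma> * p1 t) (at t)"
    and \<phi>: "\<And>t. (\<phi> has_real_derivative ((cmod (p0 t))\<^sup>2 + (cmod (p1 t))\<^sup>2) / 2) (at t)"
  shows "dimer_solution \<gamma> (\<lambda>t. cis (- \<phi> t) * p0 t) (\<lambda>t. cis (- \<phi> t) * p1 t)"
proof -
  have cis: "((\<lambda>t. cis (- \<phi> t)) has_vector_derivative
      - \<i> * of_real (((cmod (p0 t))\<^sup>2 + (cmod (p1 t))\<^sup>2) / 2) * cis (- \<phi> t)) (at t)" for t
    unfolding has_vector_derivative_complex_iff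
    by (auto intro!: derivative_eq_intros \<phi>)
  show ?thesis
    unfolding dimer_solution_iff_has_vector_derivative
    by (intro allI conjI; rule has_vector_derivative_eq_rhs,
        rule has_vector_derivative_mult[OF cis], rule p0 p1)
      (simp_all add: norm_mult field_simps)
qed

lemma unbounded_dimer_solution_gt_1:
  assumes "\<gamma> > 1"
  shows "\<exists>q0 q1. dimer_solution \<gamma> q0 q1 \<and> \<not> bounded_solution q0 q1"
proof -
  \<comment> \<open>\<open>l\<close> is the positive eigenvalue of the linear system, with
    eigenvector \<open>(1, \<i> * (\<gamma> + l))\<close>; \<open>\<phi>\<close> integrates half the
    squared norm of the resulting solution.\<close>
  define l where "l = sqrt (\<gamma>\<^sup>2 - 1)"
  have l: "l > 0" "l\<^sup>2 = \<gamma>\<^sup>2 - 1"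
    using assms by (auto simp: l_def)
  define p0 where "p0 t = complex_of_real (exp (l * t))" for t
  define p1 where "p1 t = \<i> * complex_of_real ((\<gamma> + l) * exp (l * t))" for t
  define \<phi> where "\<phi> t = (1 + (\<gamma> + l)\<^sup>2) / (4 * l) * exp (2 * l * t)" for t
  have N: "(cmod (p0 t))\<^sup>2 + (cmod (p1 t))\<^sup>2 = (1 + (\<gamma> + l)\<^sup>2) * exp (2 * l * t)" for t
    unfolding p0_def p1_def norm_mult norm_of_real power_mult_distrib power2_abs
    by (simp add: exp_double distrib_right mult.assoc)
  have p0: "(p0 has_vector_derivative - \<i> * p1 t - of_real \<gamma> * p0 t) (at t)" for t
    unfolding has_vector_derivative_complex_iff p0_def p1_def
    by (auto intro!: derivative_eq_intros simp: algebra_simps)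
  have p1: "(p1 has_vector_derivative - \<i> * p0 t + of_real \<gamma> * p1 t) (at t)" for t
  proof -
    \<comment> \<open>This is the second row of the eigenvector equation, divided by
      \<open>\<i>\<close>.\<close>
    have "(\<gamma> + l) * l = \<gamma> * (\<gamma> + l) - 1"
      using l(2) by (simp add: algebra_simps power2_eq_square)
    from arg_cong[OF this, of "\<lambda>x. x * exp (l * t)"] show ?thesis
      unfolding has_vector_derivative_complex_iff p0_def p1_def
      by (auto intro!: derivative_eq_intros simp: algebra_simps)
  qed
  have \<phi>: "(\<phi> has_real_derivative ((cmod (p0 t))\<^sup>2 + (cmod (p1 t))\<^sup>2) / 2) (at t)" for t
    unfolding N \<phi>_def using l(1) by (auto intro!: derivative_eq_intros)
  have "\<not> bounded_solution (\<lambda>t. cis (- \<phi> t) * p0 t) (\<lambda>t. cis (- \<phi> t) * p1 t)"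
  proof
    assume "bounded_solution (\<lambda>t. cis (- \<phi> t) * p0 t) (\<lambda>t. cis (- \<phi> t) * p1 t)"
    then obtain B where B: "\<And>t. (1 + (\<gamma> + l)\<^sup>2) * exp (2 * l * t) \<le> B"
      unfolding bounded_solution_def bounded_iff by (auto simp: norm_mult N abs_le_iff)
    have "1 + 2 * l * t \<le> B" for t
    proof -
      have "1 + 2 * l * t \<le> exp (2 * l * t)"
        by (rule exp_ge_add_one_self)
      also have "\<dots> \<le> (1 + (\<gamma> + l)\<^sup>2) * exp (2 * l * t)"
        by (simp add: algebra_simps)
      finally show ?thesis
        using B[of t] by simp
    qed
    \<comment> \<open>This time turns the bound into \<open>1 + B \<le> B\<close>.\<close>
    from this[of "B / (2 * l)"] show False
      using l(1) by simp
  qed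
  with dimer_solution_gauge[OF p0 p1 \<phi>] show ?thesis
    by blast
qed

lemma unbounded_dimer_solution_1:
  "\<exists>q0 q1. dimer_solution 1 q0 q1 \<and> \<not> bounded_solution q0 q1"
proof -
  \<comment> \<open>The eigenvalue is now 0, so an eigenvector solution would not grow. As the
    matrix A squares to zero, exp(tA) = I + tA, and this is its value on
    \<open>(1, 0)\<close>.\<close>
  define p0 where "p0 t = complex_of_real (1 - t)" for t
  define p1 where "p1 t = - \<i> * complex_of_real t" for t
  define \<phi> :: "real \<Rightarrow> real" where "\<phi> t = t / 2 - t\<^sup>2 / 2 + t ^ 3 / 3" for t
  have N: "(cmod (p0 t))\<^sup>2 + (cmod (p1 t))\<^sup>2 = (1 - t)\<^sup>2 + t\<^sup>2" for t
    by (simp add: p0_def p1_def cmod_power2)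
  have p0: "(p0 has_vector_derivative - \<i> * p1 t - of_real 1 * p0 t) (at t)" for t
    unfolding has_vector_derivative_complex_iff p0_def p1_def
    by (auto intro!: derivative_eq_intros)
  have p1: "(p1 has_vector_derivative - \<i> * p0 t + of_real 1 * p1 t) (at t)" for t
    unfolding has_vector_derivative_complex_iff p0_def p1_def
    by (auto intro!: derivative_eq_intros)
  have \<phi>: "(\<phi> has_real_derivative ((cmod (p0 t))\<^sup>2 + (cmod (p1 t))\<^sup>2) / 2) (at t)" for t
    unfolding N \<phi>_def
    by (auto intro!: derivative_eq_intros simp: field_simps power2_eq_square)
  have "\<not> bounded_solution (\<lambda>t. cis (- \<phi> t) * p0 t) (\<lambda>t. cis (- \<phi> t) * p1 t)"
  proof
    assume "bounded_solution (\<lambda>t. cis (- \<phi> t) * p0 t) (\<lambda>t. cis (- \<phi> t) * p1 t)"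
    then obtain B where B: "\<And>t::real. (1 - t)\<^sup>2 + t\<^sup>2 \<le> B"
      unfolding bounded_solution_def bounded_iff by (auto simp: norm_mult N)
    \<comment> \<open>At time \<open>1 + B\<close> the bound reads
      \<open>B^2 + (1 + B)^2 \<le> B\<close>; the first square is dropped.\<close>
    have "(1 + B)\<^sup>2 \<le> B"
      using B[of "1 + B"] by simp (smt (verit) zero_le_power2)
    moreover have "(1 + B)\<^sup>2 = 1 + 2 * B + B\<^sup>2"
      by (simp add: power2_sum)
    moreover have "1 \<le> B"
      using B[of 0] by simp
    ultimately show False
      using zero_le_power2[of B] by linarith
  qed
  with dimer_solution_gauge[OF p0 p1 \<phi>] show ?thesis
    by blast
qed

theorem theorem3p2:
  fixes \<gamma> :: real
  shows "(\<gamma> \<in> {0..<1} \<longrightarrow> (\<forall>q0 q1. dimer_solution \<gamma> q0 q1 \<longrightarrow> bounded_solution q0 q1)) \<and>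
         (\<gamma> \<ge> 1 \<longrightarrow> (\<exists>q0 q1. dimer_solution \<gamma> q0 q1 \<and> \<not> bounded_solution q0 q1))"
  using bounded_dimer_solution[of \<gamma>] unbounded_dimer_solution_gt_1[of \<gamma>]
    unbounded_dimer_solution_1
  by (cases "\<gamma> = 1") auto

end
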